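(* Let $T$ and $T'$ be two non-degenerate triangles in $\mathbb{R}^2$ with vertices $y_1,y_2,y_3$ and $y'_1,y'_2,y'_3$, let $M$ be in the interior of $T$ and $M'$ in the interior of $T'$ with the same barycentric coordinates ($M=\sum_j\beta_jy_j$, $M'=\sum_j\beta_jy'_j$). Let $r\in[1,\infty]$ and $n\ge1$. Let $\gamma_n$ be the domination number of the $r$-factor proportional-edge proximity catch digraph with $M$-vertex regions built on $n$ iid uniform points in $T$, and $\gamma'_n$ the analogous quantity for $T'$, $M'$ and $n$ iid uniform points in $T'$. Then $\gamma_n$ and $\gamma'_n$ have the same distribution; i.e. the distribution of the domination number does not depend on the geometry of the triangle.
   Context: For a non-collinear triple $y_1,y_2,y_3$, $T$ is the closed triangle they span, $e_j$ the edge opposite $y_j$, and $b_j(x)$ the barycentric coordinate of $x\in T$ with respect to $y_j$. For $M$ in the interior of $T$ and $k=1,2,3$, let $M_k$ be the point where the line through $y_k$ and $M$ meets $e_k$; the $M$-vertex region $R_M(y_j)$ is the closed quadrilateral with vertices $y_j,M_k,M,M_l$, $\{j,k,l\}=\{1,2,3\}$. For $x\in T\setminus\{y_1,y_2,y_3\}$ let $v(x)=y_j$ where $x\in R_M(y_j)$ (choice on common boundaries arbitrary; this occurs with probability zero). For $r\in[1,\infty)$ and such $x$ with $v(x)=y_j$, the $r$-factor proportional-edge proximity region is $N^r_{PE}(x,M)=\{z\in T: 1-b_j(z)\le r(1-b_j(x))\}$ (the intersection with $T$ of the triangle similar to $T$ with vertex $y_j$ whose opposite side is parallel to $e_j$ at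 $r$ times the distance from $y_j$ to the line through $x$ parallel to $e_j$); $N^\infty_{PE}(x,M)=T$; $N^r_{PE}(y_j,M)=\{y_j\}$. On vertex set $\{X_1,\dots,X_n\}$ the digraph has an arc $X_i\to X_j$ ($i\neq j$) iff $X_j\in N^r_{PE}(X_i,M)$; its domination number is the minimum cardinality of a vertex set $S$ such that every vertex is in $S$ or is the head of an arc from $S$. *)

theory Defs
  imports "HOL-Probability.Probability" "Graph_Theory.Pair_Digraph"
begin

text \<open>
  A triangle is given by its vertices y :: 3 => real^2, and is non-degenerate when
  the range of y is not collinear. The elements of the index type 3 are 1, 2 and 3
  (where 3 = 0).
\<close>

definition closed_triangle :: "(3 \<Rightarrow> real^2) \<Rightarrow> (real^2) set" where
  "closed_triangle y = convex hull (range y)"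

definition opposite_edge :: "(3 \<Rightarrow> real^2) \<Rightarrow> 3 \<Rightarrow> (real^2) set" where
  "opposite_edge y j = convex hull (y ` (UNIV - {j}))"

text \<open>The barycentric coordinates are unique when the vertices are not collinear.\<close>

definition barycentric :: "(3 \<Rightarrow> real^2) \<Rightarrow> real^2 \<Rightarrow> 3 \<Rightarrow> real" where
  "barycentric y x = (THE b. (\<Sum>j\<in>UNIV. b j) = 1 \<and> (\<Sum>j\<in>UNIV. b j *\<^sub>R y j) = x)"

definition cevian_foot :: "(3 \<Rightarrow> real^2) \<Rightarrow> real^2 \<Rightarrow> 3 \<Rightarrow> real^2" where
  "cevian_foot y M k = (THE p. p \<in> affine hull {y k, M} \<and> p \<in> opposite_edge y k)"

text \<open>
  For M in the interior of the triangle the quadrilateral with vertices y j, M_k, M, M_l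
  (where j, k, l are distinct) is convex, so it is the convex hull of these four points.
\<close>

definition vertex_region :: "(3 \<Rightarrow> real^2) \<Rightarrow> real^2 \<Rightarrow> 3 \<Rightarrow> (real^2) set" where
  "vertex_region y M j = convex hull ({y j, M} \<union> cevian_foot y M ` (UNIV - {j}))"

text \<open>
  An admissible assignment of vertices to points: v x = j stands for v(x) = y_j. On
  common boundaries of the vertex regions the choice is arbitrary, and in particular v
  need not be measurable.
\<close>

definition vertex_assignment :: "(3 \<Rightarrow> real^2) \<Rightarrow> real^2 \<Rightarrow> (real^2 \<Rightarrow> 3) \<Rightarrow> bool" where
  "vertex_assignment y M v \<longleftrightarrow> (\<forall>x \<in> closed_triangle y - range y. x \<in> vertex_region y M (v x))"

text \<open>The point M enters the proximity region only through the assignment v.\<close>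

definition pe_region ::
    "(3 \<Rightarrow> real^2) \<Rightarrow> (real^2 \<Rightarrow> 3) \<Rightarrow> ereal \<Rightarrow> real^2 \<Rightarrow> (real^2) set" where
  "pe_region y v r x =
     (if x \<in> range y then {x}
      else if r = \<infinity> then closed_triangle y
      else {z \<in> closed_triangle y.
              1 - barycentric y z (v x) \<le> real_of_ereal r * (1 - barycentric y x (v x))})"

definition pe_digraph ::
    "(3 \<Rightarrow> real^2) \<Rightarrow> (real^2 \<Rightarrow> 3) \<Rightarrow> ereal \<Rightarrow> (real^2) set \<Rightarrow> (real^2) pair_pre_digraph" where
  "pe_digraph y v r V =
     \<lparr> pverts = V,
       parcs = {(p, q). p \<in> V \<and> q \<in> V \<and> p \<noteq> q \<and> q \<in> pe_region y v r p} \<rparr>"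

definition dominating_set :: "('a, 'b) pre_digraph \<Rightarrow> 'a set \<Rightarrow> bool" where
  "dominating_set G S \<longleftrightarrow>
     S \<subseteq> verts G \<and> (\<forall>w \<in> verts G. w \<in> S \<or> (\<exists>u \<in> S. u \<rightarrow>\<^bsub>G\<^esub> w))"

definition domination_number :: "('a, 'b) pre_digraph \<Rightarrow> nat" where
  "domination_number G = (LEAST k. \<exists>S. finite S \<and> dominating_set G S \<and> card S = k)"

definition iid_uniform ::
    "'a measure \<Rightarrow> nat \<Rightarrow> (nat \<Rightarrow> 'a \<Rightarrow> real^2) \<Rightarrow> (real^2) set \<Rightarrow> bool" where
  "iid_uniform P n X T \<longleftrightarrow>
     prob_space.indep_vars P (\<lambda>_. borel) X {1..n} \<and>
     (\<forall>i \<in> {1..n}. distr P borel (X i) = uniform_measure lborel T)"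

definition pe_domination_number ::
    "(3 \<Rightarrow> real^2) \<Rightarrow> (real^2 \<Rightarrow> 3) \<Rightarrow> ereal \<Rightarrow> nat \<Rightarrow> (nat \<Rightarrow> 'a \<Rightarrow> real^2) \<Rightarrow> 'a \<Rightarrow> nat" where
  "pe_domination_number y v r n X \<omega> =
     domination_number (with_proj (pe_digraph y v r ((\<lambda>i. X i \<omega>) ` {1..n})))"

text \<open>
  Since v is arbitrary on the boundaries of the vertex regions (a null set), the domination
  number is in general a random variable only with respect to the completed probability
  space.
\<close>

definition same_distribution ::
    "'a measure \<Rightarrow> ('a \<Rightarrow> nat) \<Rightarrow> 'b measure \<Rightarrow> ('b \<Rightarrow> nat) \<Rightarrow> bool" where
  "same_distribution P f Q g \<longleftrightarrow>
     f \<in> measurable (completion P) (count_space UNIV) \<and>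
     g \<in> measurable (completion Q) (count_space UNIV) \<and>
     distr (completion P) (count_space UNIV) f = distr (completion Q) (count_space UNIV) g"

end

theory Submission
  imports Defs
begin

text \<open>
  Barycentric coordinates map each triangle affinely onto one reference triangle, and an
  affine bijection carries uniform measures to uniform measures. The vertex regions and the
  proximity regions are described by inequalities between barycentric coordinates, so away
  from the null set where the assignment of vertices is ambiguous the domination number is one
  and the same measurable function of the iid uniform points of the reference triangle.
\<close>

section \<open>Barycentric parametrization of a triangle\<close>

text \<open>
  The reference triangle has the vertices (1,0), (0,1) and (0,0); its points are identified
  with their coordinates, from which std_bary computes the barycentric coordinates.
\<close>

definition std_bary :: "real^2 \<Rightarrow> 3 \<Rightarrow> real" where
  "std_bary z j = (if j = 1 then z$1 else if j = 2 then z$2 else 1 - z$1 - z$2)"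

text \<open>The affine map of the whole plane that carries (1,0), (0,1), (0,0) to
  \<open>y 1\<close>, \<open>y 2\<close>, \<open>y 3\<close>; for non-collinear vertices it inverts
  the barycentric coordinates.\<close>

definition bary_param :: "(3 \<Rightarrow> real^2) \<Rightarrow> real^2 \<Rightarrow> real^2" where
  "bary_param y z = (\<Sum>j\<in>UNIV. std_bary z j *\<^sub>R y j)"

definition std_triangle :: "(real^2) set" where
  "std_triangle = {z. \<forall>j. 0 \<le> std_bary z j}"

lemma std_bary_simps [simp]:
  "std_bary z 1 = z$1" "std_bary z 2 = z$2" "std_bary z 3 = 1 - z$1 - z$2"
  by (simp_all add: std_bary_def)

lemma sum_std_bary: "(\<Sum>j\<in>UNIV. std_bary z j) = 1"
  by (simp add: sum_3)

lemma std_bary_onto: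
  assumes "(\<Sum>j\<in>UNIV. b j) = 1"
  obtains z where "std_bary z = b"
proof
  show "std_bary (vector [b 1, b 2]) = b"
    using assms by (auto simp: fun_eq_iff sum_3 forall_3)
qed

lemma std_bary_affine:
  assumes "u + w = 1"
  shows "std_bary (u *\<^sub>R z + w *\<^sub>R z') j = u * std_bary z j + w * std_bary z' j"
proof -
  have "w = 1 - u" using assms by simp
  then show ?thesis
    using exhaust_3[of j] by (auto simp: algebra_simps)
qed

lemma bary_param_affine:
  assumes "u + w = 1"
  shows "bary_param y (u *\<^sub>R z + w *\<^sub>R z') = u *\<^sub>R bary_param y z + w *\<^sub>R bary_param y z'"
  unfolding bary_param_def
  by (simp add: std_bary_affine[OF assms] scaleR_add_left sum.distrib scaleR_sum_right)

lemma convex_bary_param_image: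
  assumes "convex C"
  shows "convex (bary_param y ` C)"
  unfolding convex_def
  by (auto simp flip: bary_param_affine intro!: imageI convexD[OF assms])

lemma range_3: "range y = {y 1, y 2, y (3::3)}"
  by (auto simp: UNIV_3)

text \<open>Linear independence of the two edge vectors at \<open>y 3\<close>. In a relation with
  \<open>t \<noteq> 0\<close> the second vector would be a multiple of the first, contrary to
  \<open>collinear_lemma\<close>; and \<open>t = 0\<close> forces \<open>s = 0\<close> because the
  first vector is nonzero.\<close>

lemma noncollinear_zero_combination:
  fixes y :: "3 \<Rightarrow> real^2"
  assumes nc: "\<not> collinear (range y)"
    and s: "s *\<^sub>R (y 1 - y 3) + t *\<^sub>R (y 2 - y 3) = 0"
  shows "s = 0 \<and> t = 0"
proof (rule ccontr)
  assume "\<not> (s = 0 \<and> t = 0)"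
  have "\<not> collinear {0, y 1 - y 3, y 2 - y 3}"
    using nc collinear_3[of "y 1" "y 3" "y 2"] by (simp add: range_3 insert_commute NO_MATCH_def)
  then have ne: "y 1 - y 3 \<noteq> 0" "y 2 - y 3 \<noteq> 0" "\<And>c. y 2 - y 3 \<noteq> c *\<^sub>R (y 1 - y 3)"
    unfolding collinear_lemma by blast+
  have t0: "t \<noteq> 0"
    using s ne \<open>\<not> (s = 0 \<and> t = 0)\<close> by auto
  have "t *\<^sub>R (y 2 - y 3) = - s *\<^sub>R (y 1 - y 3)"
    using s by (simp add: add_eq_0_iff2)
  then have "(1/t) *\<^sub>R (t *\<^sub>R (y 2 - y 3)) = (1/t) *\<^sub>R (- s *\<^sub>R (y 1 - y 3))" by simp
  then have "y 2 - y 3 = (-s/t) *\<^sub>R (y 1 - y 3)"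
    using t0 by simp
  then show False using ne by blast
qed

text \<open>Splits off the translation by \<open>y 3\<close>, so that bijectivity, measurability of
  the inverse and the scaling of area reduce to facts about a linear map.\<close>

lemma bary_param_eq:
  "bary_param y z = y 3 + (z$1 *\<^sub>R (y 1 - y 3) + z$2 *\<^sub>R (y 2 - y 3))"
  by (simp add: bary_param_def sum_3 algebra_simps)

lemma linear_bary_param: "linear (\<lambda>z::real^2. z$1 *\<^sub>R (y 1 - y 3) + z$2 *\<^sub>R (y 2 - y (3::3) :: real^2))"
  by (rule linearI) (simp_all add: algebra_simps)

lemma inj_linear_bary_param:
  fixes y :: "3 \<Rightarrow> real^2"
  assumes "\<not> collinear (range y)"
  shows "inj (\<lambda>z::real^2. z$1 *\<^sub>R (y 1 - y 3) + z$2 *\<^sub>R (y 2 - y 3))"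
proof -
  have "z = 0" if "z$1 *\<^sub>R (y 1 - y 3) + z$2 *\<^sub>R (y 2 - y 3) = 0" for z :: "real^2"
    using noncollinear_zero_combination[OF assms that] by (simp add: vec_eq_iff forall_2)
  then show ?thesis
    using linear_injective_0[OF linear_bary_param] by blast
qed

lemma bij_bary_param:
  assumes "\<not> collinear (range y)"
  shows "bij (bary_param y)"
proof -
  let ?L = "\<lambda>z::real^2. z$1 *\<^sub>R (y 1 - y 3) + z$2 *\<^sub>R (y 2 - y 3)"
  have "bij ?L"
    using inj_linear_bary_param[OF assms] linear_injective_imp_surjective[OF linear_bary_param]
    by (auto simp: bij_def)
  then have "bij ((\<lambda>x. y 3 + x) \<circ> ?L)"
    by (intro bij_comp) (auto intro!: bij_plus_right)
  then show ?thesis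
    by (simp add: bary_param_eq[abs_def] o_def)
qed

text \<open>Any competing weights with sum 1 are \<open>std_bary z'\<close> for some
  \<open>z'\<close>, and injectivity of \<open>bary_param y\<close> gives
  \<open>z' = z\<close>.\<close>

lemma barycentric_bary_param:
  assumes "\<not> collinear (range y)"
  shows "barycentric y (bary_param y z) = std_bary z"
  unfolding barycentric_def
proof (rule the_equality)
  show "sum (std_bary z) UNIV = 1 \<and> (\<Sum>j\<in>UNIV. std_bary z j *\<^sub>R y j) = bary_param y z"
    by (simp only: sum_std_bary bary_param_def simp_thms)
next
  fix b :: "3 \<Rightarrow> real"
  assume b: "sum b UNIV = 1 \<and> (\<Sum>j\<in>UNIV. b j *\<^sub>R y j) = bary_param y z"
  then obtain z' where z': "std_bary z' = b"
    using std_bary_onto by blast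
  then have "bary_param y z' = bary_param y z"
    using b by (simp add: bary_param_def)
  then show "b = std_bary z"
    using z' bij_is_inj[OF bij_bary_param[OF assms]] by (auto dest: injD)
qed

lemma closed_triangle_eq: "closed_triangle y = bary_param y ` std_triangle"
proof -
  have "closed_triangle y = {u *\<^sub>R y 1 + v *\<^sub>R y 2 + w *\<^sub>R y 3 | u v w. 0 \<le> u \<and> 0 \<le> v \<and> 0 \<le> w \<and> u + v + w = 1}"
    by (simp add: closed_triangle_def range_3 convex_hull_3)
  also have "\<dots> = bary_param y ` std_triangle"
  proof (intro set_eqI iffI)
    fix x assume "x \<in> {u *\<^sub>R y 1 + v *\<^sub>R y 2 + w *\<^sub>R y 3 | u v w. 0 \<le> u \<and> 0 \<le> v \<and> 0 \<le> w \<and> u + v + w = 1}"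
    then obtain u v w where *: "x = u *\<^sub>R y 1 + v *\<^sub>R y 2 + w *\<^sub>R y 3" "0 \<le> u" "0 \<le> v" "0 \<le> w"
      "u + v + w = 1" by blast
    have w: "w = 1 - u - v" using * by simp
    have "x = bary_param y (vector [u, v])" "vector [u, v] \<in> std_triangle"
      using * by (simp_all add: bary_param_def sum_3 std_triangle_def forall_3 w)
    then show "x \<in> bary_param y ` std_triangle" by blast
  next
    fix x assume "x \<in> bary_param y ` std_triangle"
    then obtain z where z: "x = bary_param y z" "z \<in> std_triangle" by blast
    show "x \<in> {u *\<^sub>R y 1 + v *\<^sub>R y 2 + w *\<^sub>R y 3 | u v w. 0 \<le> u \<and> 0 \<le> v \<and> 0 \<le> w \<and> u + v + w = 1}"
      using z by (intro CollectI exI[of _ "z$1"] exI[of _ "z$2"] exI[of _ "1 - z$1 - z$2"])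
        (auto simp: bary_param_def sum_3 std_triangle_def forall_3)
  qed
  finally show ?thesis .
qed

lemma bary_param_vertex:
  obtains z where "bary_param y z = y j" "std_bary z = (\<lambda>i. if i = j then 1 else 0)"
proof -
  obtain z where z: "std_bary z = (\<lambda>i. if i = j then 1 else 0)"
    by (rule std_bary_onto[of "\<lambda>i. if i = j then 1 else 0"]) simp
  show thesis
  proof (rule that)
    show "bary_param y z = y j"
      by (simp add: bary_param_def z if_distrib[of "\<lambda>c. c *\<^sub>R _"] cong: if_cong)
  qed (rule z)
qed

text \<open>A point slightly beyond \<open>?M\<close> on the line from \<open>y j\<close> through
  \<open>?M\<close> still lies in the triangle, and its nonnegative coordinate \<open>j\<close> is
  \<open>(1 + e) * std_bary m j - e\<close> with \<open>e > 0\<close>.\<close>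

lemma interior_std_bary_pos:
  assumes nc: "\<not> collinear (range y)" and M: "bary_param y m \<in> interior (closed_triangle y)"
  shows "0 < std_bary m j"
proof -
  let ?M = "bary_param y m"
  obtain z where z: "bary_param y z = y j" "std_bary z = (\<lambda>i. if i = j then 1 else 0)"
    by (rule bary_param_vertex)
  have "((\<lambda>e. (1 + e) *\<^sub>R ?M + (-e) *\<^sub>R y j) \<longlongrightarrow> (1 + 0) *\<^sub>R ?M + (-0) *\<^sub>R y j) (at_right 0)"
    by (intro tendsto_intros)
  then have "\<forall>\<^sub>F e in at_right 0. (1 + e) *\<^sub>R ?M + (-e) *\<^sub>R y j \<in> interior (closed_triangle y)"
    using M by (intro topological_tendstoD) auto
  moreover have "\<forall>\<^sub>F e in at_right (0::real). 0 < e"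
    by (simp add: eventually_at_right_less)
  ultimately have "\<forall>\<^sub>F e in at_right 0. 0 < e \<and> (1 + e) *\<^sub>R ?M + (-e) *\<^sub>R y j \<in> closed_triangle y"
    using interior_subset by (fastforce elim: eventually_elim2)
  then obtain e :: real where e: "0 < e" "(1 + e) *\<^sub>R ?M + (-e) *\<^sub>R y j \<in> closed_triangle y"
    using eventually_happens'[OF trivial_limit_at_right_real] by blast
  have "(1 + e) *\<^sub>R ?M + (-e) *\<^sub>R y j = bary_param y ((1 + e) *\<^sub>R m + (-e) *\<^sub>R z)"
    using bary_param_affine[of "1 + e" "-e" y m z] z(1) by simp
  then have "(1 + e) *\<^sub>R m + (-e) *\<^sub>R z \<in> std_triangle"
    using e(2) bij_is_inj[OF bij_bary_param[OF nc]] by (simp add: closed_triangle_eq inj_image_mem_iff)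
  then have "0 \<le> std_bary ((1 + e) *\<^sub>R m + (-e) *\<^sub>R z) j"
    by (simp add: std_triangle_def)
  then have "e \<le> (1 + e) * std_bary m j"
    by (subst (asm) std_bary_affine) (simp_all add: z(2))
  then have "0 < (1 + e) * std_bary m j"
    using e(1) by linarith
  then show ?thesis
    using e(1) by (simp add: zero_less_mult_iff)
qed

section \<open>Vertex regions in barycentric coordinates\<close>

text \<open>
  The cevians through m are the lines on which two of the ratios of barycentric
  coordinates to those of m agree, so the vertex region of y j consists of the points for
  which the ratio with index j is maximal.
\<close>

definition max_ratio :: "real^2 \<Rightarrow> real^2 \<Rightarrow> 3 \<Rightarrow> bool" where
  "max_ratio m z j \<longleftrightarrow> (\<forall>k. std_bary z k * std_bary m j \<le> std_bary z j * std_bary m k)"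

text \<open>For fixed \<open>m\<close> the defining inequalities are linear in
  \<open>z\<close>.\<close>

lemma convex_max_ratio: "convex {z. max_ratio m z j}"
proof -
  have "(u * std_bary z k + w * std_bary z' k) * std_bary m j
      \<le> (u * std_bary z j + w * std_bary z' j) * std_bary m k"
    if "max_ratio m z j" "max_ratio m z' j" "0 \<le> u" "0 \<le> w" for z z' u w k
  proof -
    have "u * (std_bary z k * std_bary m j) + w * (std_bary z' k * std_bary m j)
      \<le> u * (std_bary z j * std_bary m k) + w * (std_bary z' j * std_bary m k)"
      using that by (intro add_mono mult_left_mono) (auto simp: max_ratio_def)
    then show ?thesis
      by (simp add: algebra_simps)
  qed
  then show ?thesis
    by (simp add: convex_def max_ratio_def[of _ "_ + _"] std_bary_affine)
qed

text \<open>Serves the uniqueness of the cevian foot; \<open>bary_param_in_opposite_edge\<close>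
  serves its existence.\<close>

lemma opposite_edge_subset: "opposite_edge y k \<subseteq> bary_param y ` {z. std_bary z k = 0}"
  unfolding opposite_edge_def
proof (rule hull_minimal)
  show "y ` (UNIV - {k}) \<subseteq> bary_param y ` {z. std_bary z k = 0}"
  proof (rule image_subsetI)
    fix i assume "i \<in> UNIV - {k}"
    obtain z where "bary_param y z = y i" "std_bary z = (\<lambda>l. if l = i then 1 else 0)"
      by (rule bary_param_vertex)
    with \<open>i \<in> UNIV - {k}\<close> show "y i \<in> bary_param y ` {z. std_bary z k = 0}"
      by (intro image_eqI[of _ _ z]) auto
  qed
  show "convex (bary_param y ` {z. std_bary z k = 0})"
    by (rule convex_bary_param_image) (auto simp: convex_def std_bary_affine)
qed

lemma bary_param_in_opposite_edge:
  assumes "z \<in> std_triangle" "std_bary z k = 0"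
  shows "bary_param y z \<in> opposite_edge y k"
proof -
  have "(\<Sum>j\<in>UNIV - {k}. std_bary z j *\<^sub>R y j) \<in> opposite_edge y k"
    unfolding opposite_edge_def
  proof (rule convex_sum)
    show "sum (std_bary z) (UNIV - {k}) = 1"
      using sum_std_bary[of z] assms(2) by (simp add: sum_diff1)
  qed (use assms(1) in \<open>auto simp: std_triangle_def intro: hull_inc\<close>)
  then show ?thesis
    using assms(2) by (simp add: bary_param_def sum_diff1)
qed

lemma cevian_foot_eq:
  assumes nc: "\<not> collinear (range y)" and pos: "\<And>j. 0 < std_bary m j"
  obtains z where "cevian_foot y (bary_param y m) k = bary_param y z"
    "std_bary z = (\<lambda>i. if i = k then 0 else std_bary m i / (1 - std_bary m k))"
proof -
  have inj: "inj (bary_param y)"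
    using bij_is_inj[OF bij_bary_param[OF nc]] .
  have m1: "std_bary m k < 1"
    using pos[of 1] pos[of 2] pos[of 3] exhaust_3[of k] by auto
  obtain c where c: "bary_param y c = y k" "std_bary c = (\<lambda>i. if i = k then 1 else 0)"
    by (rule bary_param_vertex)
  \<comment> \<open>The weights have sum 1 and cancel coordinate \<open>k\<close>, which is 1 at
    \<open>c\<close> and \<open>std_bary m k\<close> at \<open>m\<close>. The other coordinates are
    those of \<open>m\<close>, rescaled to sum to 1.\<close>
  define z where "z = (- std_bary m k / (1 - std_bary m k)) *\<^sub>R c + (1 / (1 - std_bary m k)) *\<^sub>R m"
  have sum1: "(- std_bary m k / (1 - std_bary m k)) + (1 / (1 - std_bary m k)) = 1"
    using m1 by (simp add: field_simps)
  have z: "std_bary z = (\<lambda>i. if i = k then 0 else std_bary m i / (1 - std_bary m k))"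
    unfolding z_def std_bary_affine[OF sum1] fun_eq_iff c using m1 by auto
  have "cevian_foot y (bary_param y m) k = bary_param y z"
    unfolding cevian_foot_def
  proof (rule the_equality, intro conjI)
    show "bary_param y z \<in> affine hull {y k, bary_param y m}"
      unfolding affine_hull_2 z_def bary_param_affine[OF sum1] c(1) using sum1 by blast
    show "bary_param y z \<in> opposite_edge y k"
      using pos m1 by (intro bary_param_in_opposite_edge)
        (auto simp: std_triangle_def z less_imp_le)
  next
    fix p assume p: "p \<in> affine hull {y k, bary_param y m} \<and> p \<in> opposite_edge y k"
    then obtain u w where uw: "p = u *\<^sub>R y k + w *\<^sub>R bary_param y m" "u + w = 1"
      by (auto simp: affine_hull_2)
    then have pz: "p = bary_param y (u *\<^sub>R c + w *\<^sub>R m)"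
      by (simp add: bary_param_affine c)
    moreover obtain z' where "p = bary_param y z'" "std_bary z' k = 0"
      using p opposite_edge_subset[of y k] by blast
    ultimately have "std_bary (u *\<^sub>R c + w *\<^sub>R m) k = 0"
      using inj by (auto dest: injD)
    \<comment> \<open>Together with \<open>u + w = 1\<close> this determines both weights, because
      \<open>std_bary m k < 1\<close>.\<close>
    then have "u + w * std_bary m k = 0"
      using uw by (simp add: std_bary_affine c)
    then have "w * (1 - std_bary m k) = 1"
      using uw(2) by (simp add: algebra_simps)
    then have w: "w = 1 / (1 - std_bary m k)"
      using m1 by (simp add: field_simps)
    then have "u = - std_bary m k / (1 - std_bary m k)"
      using uw(2) sum1 by linarith
    then show "p = bary_param y z"
      using pz w by (simp add: z_def)
  qed
  then show thesis using z that by blast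
qed

text \<open>The target is convex, so it is enough to check the four corners of the quadrilateral.
  The inclusion pins down an admissible assignment wherever only one index has maximal
  ratio.\<close>

lemma vertex_region_subset:
  assumes nc: "\<not> collinear (range y)" and pos: "\<And>j. 0 < std_bary m j"
  shows "vertex_region y (bary_param y m) j \<subseteq> bary_param y ` {z. max_ratio m z j}"
  unfolding vertex_region_def
proof (rule hull_minimal)
  show "convex (bary_param y ` {z. max_ratio m z j})"
    by (intro convex_bary_param_image convex_max_ratio)
  have "y j \<in> bary_param y ` {z. max_ratio m z j}"
  proof -
    obtain z where "bary_param y z = y j" "std_bary z = (\<lambda>l. if l = j then 1 else 0)"
      by (rule bary_param_vertex)
    then show ?thesis
      using pos by (intro image_eqI[of _ _ z]) (auto simp: max_ratio_def less_imp_le)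
  qed
  moreover have "bary_param y m \<in> bary_param y ` {z. max_ratio m z j}"
    by (auto simp: max_ratio_def)
  moreover have "cevian_foot y (bary_param y m) k \<in> bary_param y ` {z. max_ratio m z j}"
    if "k \<noteq> j" for k
  proof -
    have m1: "std_bary m k < 1"
      using pos[of 1] pos[of 2] pos[of 3] exhaust_3[of k] by auto
    obtain z where z: "cevian_foot y (bary_param y m) k = bary_param y z"
      "std_bary z = (\<lambda>i. if i = k then 0 else std_bary m i / (1 - std_bary m k))"
      using cevian_foot_eq[OF nc pos] by blast
    \<comment> \<open>At the foot on the edge opposite \<open>y k\<close> the ratio with index
      \<open>k\<close> is 0 and the other two both equal \<open>1 / (1 - std_bary m k)\<close>, so
      every \<open>j \<noteq> k\<close> is maximal.\<close>
    have "max_ratio m z j"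
      using that pos m1 by (auto simp: max_ratio_def z less_imp_le mult.commute)
    then show ?thesis using z by simp
  qed
  ultimately show "{y j, bary_param y m} \<union> cevian_foot y (bary_param y m) ` (UNIV - {j})
      \<subseteq> bary_param y ` {z. max_ratio m z j}"
    by blast
qed

section \<open>Domination by sets of indices\<close>

text \<open>Replaces random vertex sets by subsets of a fixed finite index set, over which
  measurability is a finite matter. The alternative \<open>f w = f u\<close> makes the formula
  correct also when several indices give the same vertex.\<close>

lemma domination_number_image:
  fixes f :: "'i \<Rightarrow> 'v" and N :: "'v \<Rightarrow> 'v set"
  assumes "finite I"
  defines "G \<equiv> \<lparr> pverts = f ` I, parcs = {(p, q). p \<in> f ` I \<and> q \<in> f ` I \<and> p \<noteq> q \<and> q \<in> N p} \<rparr>"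
  shows "domination_number (with_proj G) =
    (LEAST k. \<exists>J\<in>Pow I. card J = k \<and> (\<forall>w\<in>I. \<exists>u\<in>J. f w = f u \<or> f w \<in> N (f u)))"
    (is "_ = (LEAST k. ?Q k)")
proof -
  let ?P = "\<lambda>k. \<exists>S. finite S \<and> dominating_set (with_proj G) S \<and> card S = k"
  have dom: "dominating_set (with_proj G) S \<longleftrightarrow>
      S \<subseteq> f ` I \<and> (\<forall>w\<in>I. f w \<in> S \<or> (\<exists>u\<in>S. f w \<in> N u))" for S
    by (fastforce simp: dominating_set_def G_def)
  \<comment> \<open>The image of an index set can be smaller than the set itself, hence only
    \<open>k' \<le> k\<close>.\<close>
  have image: "\<exists>k'\<le>k. ?P k'" if "?Q k" for k
  proof -
    obtain J where J: "J \<subseteq> I" "card J = k" "\<forall>w\<in>I. \<exists>u\<in>J. f w = f u \<or> f w \<in> N (f u)"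
      using \<open>?Q k\<close> by auto
    have "finite J" using J(1) assms(1) finite_subset by blast
    then have "card (f ` J) \<le> k" "finite (f ` J)"
      using J(2) card_image_le by blast+
    moreover have "dominating_set (with_proj G) (f ` J)"
      unfolding dom using J by blast
    ultimately show ?thesis by blast
  qed
  have preimage: "?Q k" if "?P k" for k
  proof -
    obtain S where S: "dominating_set (with_proj G) S" "card S = k" using \<open>?P k\<close> by blast
    have sub: "S \<subseteq> f ` I" using S(1) dom by blast
    \<comment> \<open>One index is chosen for each vertex of \<open>S\<close>, which preserves the
      cardinality.\<close>
    then obtain J where J: "J \<subseteq> I" "inj_on f J" "S = f ` J"
      by (auto simp: subset_image_inj)
    have "card J = k" using S(2) J card_image by metis
    moreover have "\<forall>w\<in>I. \<exists>u\<in>J. f w = f u \<or> f w \<in> N (f u)"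
      using S(1) unfolding dom J by blast
    ultimately show ?thesis using J(1) by blast
  qed
  \<comment> \<open>All of \<open>I\<close> dominates, since each index dominates itself; hence both
    minima are attained.\<close>
  have "?Q (card I)" by blast
  then have "?Q (LEAST k. ?Q k)" by (rule LeastI)
  then obtain k' where k': "k' \<le> (LEAST k. ?Q k)" "?P k'" using image by blast
  then have "?Q (LEAST k. ?P k)"
    by (intro preimage) (rule LeastI)
  then have "(LEAST k. ?Q k) \<le> (LEAST k. ?P k)" by (rule Least_le)
  moreover have "(LEAST k. ?P k) \<le> k'" using k'(2) by (rule Least_le)
  ultimately show ?thesis
    using k'(1) by (simp add: domination_number_def)
qed

section \<open>Reduction to the reference triangle\<close>

text \<open>The union of the three lines through \<open>m\<close> and a vertex; it contains the
  common boundaries of the vertex regions.\<close>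

definition tie :: "real^2 \<Rightarrow> real^2 \<Rightarrow> bool" where
  "tie m z \<longleftrightarrow> (\<exists>j k. j \<noteq> k \<and> std_bary z j * std_bary m k = std_bary z k * std_bary m j)"

text \<open>The quantifier over \<open>j\<close> stands in for the arbitrary assignment and keeps
  the relation measurable. The case \<open>r = \<infinity>\<close> is separate because
  \<open>real_of_ereal \<infinity>\<close> is 0.\<close>

definition std_arc :: "real^2 \<Rightarrow> ereal \<Rightarrow> real^2 \<Rightarrow> real^2 \<Rightarrow> bool" where
  "std_arc m r z w \<longleftrightarrow> r = \<infinity> \<or>
     (\<exists>j. max_ratio m z j \<and> 1 - std_bary w j \<le> real_of_ereal r * (1 - std_bary z j))"

definition std_domination_number :: "real^2 \<Rightarrow> ereal \<Rightarrow> nat \<Rightarrow> (nat \<Rightarrow> real^2) \<Rightarrow> nat" where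
  "std_domination_number m r n z =
     (LEAST k. \<exists>J\<in>Pow {1..n}. card J = k \<and> (\<forall>w\<in>{1..n}. \<exists>u\<in>J. std_arc m r (z u) (z w)))"

lemma std_bary_le_1:
  assumes "z \<in> std_triangle"
  shows "std_bary z j \<le> 1"
  using sum_std_bary[of z] member_le_sum[of j UNIV "std_bary z"] assms
  by (simp add: std_triangle_def)

text \<open>The two other coordinates vanish at a vertex, so their equation reads
  \<open>0 = 0\<close>. Excluding ties therefore also excludes the vertices, where
  \<open>pe_region\<close> is a singleton.\<close>

lemma vertex_tie:
  assumes "std_bary z = (\<lambda>i. if i = j then 1 else 0)"
  shows "tie m z"
proof -
  \<comment> \<open>Arithmetic in the index type is modulo 3.\<close>
  have "\<exists>k l. k \<noteq> l \<and> k \<noteq> j \<and> l \<noteq> (j::3)"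
    by (rule exI[of _ "j + 1"], rule exI[of _ "j + 2"]) simp
  then show ?thesis
    unfolding tie_def assms by fastforce
qed

lemma max_ratio_unique:
  assumes "\<not> tie m z" "max_ratio m z j" "max_ratio m z k"
  shows "j = k"
  using assms unfolding tie_def max_ratio_def by (meson order_antisym)

text \<open>Off the ties the assigned index must be the unique one with maximal ratio, so every
  admissible \<open>v\<close> yields the same arcs.\<close>

lemma pe_region_iff_std_arc:
  assumes nc: "\<not> collinear (range y)" and pos: "\<And>j. 0 < std_bary m j"
    and v: "vertex_assignment y (bary_param y m) v" and r: "1 \<le> r"
    and z: "z \<in> std_triangle" "\<not> tie m z" and w: "w \<in> std_triangle"
  shows "bary_param y w = bary_param y z \<or> bary_param y w \<in> pe_region y v r (bary_param y z)
    \<longleftrightarrow> std_arc m r z w"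
proof -
  have inj: "bary_param y a = bary_param y b \<longleftrightarrow> a = b" for a b
    using bij_is_inj[OF bij_bary_param[OF nc]] by (simp add: inj_eq)
  have nv: "bary_param y z \<notin> range y"
  proof
    assume "bary_param y z \<in> range y"
    then obtain j where j: "bary_param y z = y j" by blast
    obtain c where "bary_param y c = y j" "std_bary c = (\<lambda>i. if i = j then 1 else 0)"
      by (rule bary_param_vertex)
    then show False
      using j inj vertex_tie z(2) by metis
  qed
  define j where "j = v (bary_param y z)"
  have "bary_param y z \<in> closed_triangle y - range y"
    using z nv by (simp add: closed_triangle_eq)
  then have "bary_param y z \<in> vertex_region y (bary_param y m) j"
    using v by (simp add: vertex_assignment_def j_def)
  then have j: "max_ratio m z j"
    using vertex_region_subset[OF nc pos] inj by (metis (no_types, lifting) imageE mem_Collect_eq subsetD)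
  have w': "bary_param y w \<in> closed_triangle y"
    using w by (simp add: closed_triangle_eq)
  show ?thesis
  proof (cases "r = \<infinity>")
    case True
    then show ?thesis using nv w' by (simp add: pe_region_def std_arc_def)
  next
    case False
    then have r1: "1 \<le> real_of_ereal r"
      using r by (cases r) auto
    \<comment> \<open>Because \<open>r\<close> is at least 1, \<open>std_arc m r z z\<close> holds;
      this absorbs the alternative that the two points coincide.\<close>
    have "1 * (1 - std_bary z j) \<le> real_of_ereal r * (1 - std_bary z j)"
      using r1 std_bary_le_1[OF z(1)] by (intro mult_right_mono) auto
    moreover have "max_ratio m z i \<longleftrightarrow> i = j" for i
      using j max_ratio_unique[OF z(2)] by metis
    then have "std_arc m r z w \<longleftrightarrow> 1 - std_bary w j \<le> real_of_ereal r * (1 - std_bary z j)"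
      using False by (simp add: std_arc_def)
    moreover have "bary_param y w \<in> pe_region y v r (bary_param y z)
        \<longleftrightarrow> 1 - std_bary w j \<le> real_of_ereal r * (1 - std_bary z j)"
      using False nv w' by (simp add: pe_region_def barycentric_bary_param[OF nc] flip: j_def)
    ultimately show ?thesis by (auto simp: inj)
  qed
qed

lemma pe_domination_number_eq_std:
  assumes nc: "\<not> collinear (range y)" and pos: "\<And>j. 0 < std_bary m j"
    and v: "vertex_assignment y (bary_param y m) v" and r: "1 \<le> r"
    and z: "\<And>i. i \<in> {1..n} \<Longrightarrow> z i \<in> std_triangle \<and> \<not> tie m (z i) \<and> X i \<omega> = bary_param y (z i)"
  shows "pe_domination_number y v r n X \<omega> = std_domination_number m r n z"
proof -
  have "(\<forall>w\<in>{1..n}. \<exists>u\<in>J. X w \<omega> = X u \<omega> \<or> X w \<omega> \<in> pe_region y v r (X u \<omega>)) \<longleftrightarrow>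
      (\<forall>w\<in>{1..n}. \<exists>u\<in>J. std_arc m r (z u) (z w))" if "J \<in> Pow {1..n}" for J
    using that z pe_region_iff_std_arc[OF nc pos v r]
    by (intro ball_cong bex_cong) (auto simp: subset_iff)
  then have *: "(\<exists>J\<in>Pow {1..n}. card J = k \<and>
        (\<forall>w\<in>{1..n}. \<exists>u\<in>J. X w \<omega> = X u \<omega> \<or> X w \<omega> \<in> pe_region y v r (X u \<omega>))) \<longleftrightarrow>
      (\<exists>J\<in>Pow {1..n}. card J = k \<and> (\<forall>w\<in>{1..n}. \<exists>u\<in>J. std_arc m r (z u) (z w)))" for k
    by (intro bex_cong refl) (simp only:)
  show ?thesis
    unfolding pe_domination_number_def pe_digraph_def std_domination_number_def
    by (simp only: domination_number_image finite_atLeastAtMost *)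
qed

section \<open>Measurability, and ties as a null set\<close>

lemma measurable_std_bary [measurable]: "(\<lambda>z. std_bary z j) \<in> borel_measurable borel"
  unfolding std_bary_def by measurable

lemma sets_std_triangle [measurable]: "std_triangle \<in> sets borel"
  unfolding std_triangle_def by measurable

lemma measurable_std_arc [measurable]:
  "Measurable.pred (borel \<Otimes>\<^sub>M borel) (\<lambda>x. std_arc m r (fst x) (snd x))"
  unfolding std_arc_def max_ratio_def by measurable

text \<open>For each \<open>k\<close> the predicate under \<open>LEAST\<close> is a finite Boolean
  combination of arc events between two coordinates.\<close>

lemma measurable_std_domination_number [measurable]:
  "std_domination_number m r n \<in> (\<Pi>\<^sub>M i\<in>{1..n}. borel) \<rightarrow>\<^sub>M count_space UNIV"
proof -
  have *: "Measurable.pred (\<Pi>\<^sub>M i\<in>{1..n}. borel) (\<lambda>z. std_arc m r (z u) (z w))"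
    if "u \<in> {1..n}" "w \<in> {1..n}" for u w
  proof -
    have "(\<lambda>z. (z u, z w)) \<in> (\<Pi>\<^sub>M i\<in>{1..n}. borel) \<rightarrow>\<^sub>M borel \<Otimes>\<^sub>M (borel :: (real^2) measure)"
      using that by measurable
    from measurable_compose[OF this measurable_std_arc] show ?thesis by simp
  qed
  show ?thesis
    unfolding std_domination_number_def[abs_def]
    by (intro measurable_Least pred_intros_finite pred_intros_logic)
      (auto simp del: One_nat_def intro!: * intro: finite_subset dest: subsetD)
qed

lemma std_bary_inner:
  obtains a d where "\<And>z. std_bary z j = a \<bullet> z + d"
proof -
  consider "j = 1" | "j = 2" | "j = 3"
    using exhaust_3 by blast
  then show thesis
  proof cases
    case 1
    show ?thesis by (rule that[of "axis 1 1" 0]) (simp add: 1 inner_axis')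
  next
    case 2
    show ?thesis by (rule that[of "axis 2 1" 0]) (simp add: 2 inner_axis')
  next
    case 3
    show ?thesis
      by (rule that[of "- axis 1 1 - axis 2 1" 1]) (simp add: 3 inner_axis' inner_diff_left)
  qed
qed

text \<open>For each pair of indices the ties lie on a line \<open>A \<bullet> z = b\<close>, which
  is negligible once \<open>A \<noteq> 0\<close>.\<close>

lemma AE_not_tie:
  assumes pos: "\<And>j. 0 < std_bary m j"
  shows "AE z in lborel. \<not> tie m z"
proof -
  have line: "AE z in lborel. std_bary z j * std_bary m k \<noteq> std_bary z k * std_bary m j"
    if "j \<noteq> k" for j k
  proof -
    obtain a d where a: "\<And>z. std_bary z j = a \<bullet> z + d" by (rule std_bary_inner[of j]) blast
    obtain a' d' where a': "\<And>z. std_bary z k = a' \<bullet> z + d'" by (rule std_bary_inner[of k]) blast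
    define A where "A = std_bary m k *\<^sub>R a - std_bary m j *\<^sub>R a'"
    define b where "b = std_bary m j * d' - std_bary m k * d"
    have A: "std_bary z j * std_bary m k - std_bary z k * std_bary m j = A \<bullet> z - b" for z
      by (simp add: a[of z] a'[of z] A_def b_def inner_diff_left algebra_simps)
    \<comment> \<open>At the reference vertices \<open>j\<close> and \<open>k\<close> the functional
      takes the values \<open>std_bary m k > 0\<close> and \<open>- std_bary m j < 0\<close>, so it
      is not constant.\<close>
    obtain z where "std_bary z = (\<lambda>i. if i = j then 1 else 0)"
      using bary_param_vertex by blast
    moreover obtain z' where "std_bary z' = (\<lambda>i. if i = k then 1 else 0)"
      using bary_param_vertex by blast
    ultimately have "A \<bullet> z - b > 0" "A \<bullet> z' - b < 0"
      using A[of z] A[of z'] that pos[of j] pos[of k] by auto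
    then have "A \<noteq> 0" by auto
    then have "{z. A \<bullet> z = b} \<in> null_sets lebesgue"
      using negligible_hyperplane negligible_iff_null_sets by blast
    then have "{z. A \<bullet> z = b} \<in> null_sets lborel"
      by (subst (asm) null_sets_completion_iff) measurable
    then have "AE z in lborel. A \<bullet> z \<noteq> b"
      using AE_not_in by fastforce
    then show ?thesis
    proof (rule eventually_mono)
      fix z assume "A \<bullet> z \<noteq> b"
      then show "std_bary z j * std_bary m k \<noteq> std_bary z k * std_bary m j"
        using A[of z] by auto
    qed
  qed
  have "AE z in lborel. \<forall>j k. j \<noteq> k \<longrightarrow> std_bary z j * std_bary m k \<noteq> std_bary z k * std_bary m j"
    using line by (simp add: AE_all_countable)
  then show ?thesis
    by (auto simp: tie_def elim!: eventually_mono)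
qed

section \<open>Transport of the uniform distribution\<close>

lemma measurable_inv_bary_param:
  assumes nc: "\<not> collinear (range y)"
  shows "inv (bary_param y) \<in> borel_measurable borel"
proof -
  let ?L = "\<lambda>z::real^2. z$1 *\<^sub>R (y 1 - y 3) + z$2 *\<^sub>R (y 2 - y 3)"
  obtain g where g: "linear g" "\<And>x. g (?L x) = x" "\<And>x. ?L (g x) = x"
    using linear_injective_isomorphism[OF linear_bary_param inj_linear_bary_param[OF nc]] by auto
  have "inv (bary_param y) = (\<lambda>x. g (x - y 3))"
    by (rule inv_equality) (simp_all only: bary_param_eq g add_diff_eq add_diff_cancel_left')
  moreover have "g \<in> borel_measurable borel"
    using g(1) by (intro borel_measurable_continuous_onI linear_continuous_on)
      (simp add: linear_conv_bounded_linear)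
  ultimately show ?thesis by simp
qed

lemma sets_bary_param_image:
  assumes nc: "\<not> collinear (range y)" and S: "S \<in> sets borel"
  shows "bary_param y ` S \<in> sets borel"
  using measurable_sets[OF measurable_inv_bary_param[OF nc] S] bij_bary_param[OF nc]
  by (simp add: bij_vimage_eq_inv_image bij_imp_bij_inv inv_inv_eq)

text \<open>The factor is the absolute determinant of the linear part; the translation preserves
  area. Boundedness makes \<open>S\<close> \<open>lmeasurable\<close>, so the determinant formula
  for real-valued measures applies.\<close>

lemma emeasure_bary_param_image:
  assumes nc: "\<not> collinear (range y)"
  obtains c :: real where "0 < c"
    "\<And>S. S \<in> sets borel \<Longrightarrow> bounded S \<Longrightarrow>
      emeasure lborel (bary_param y ` S) = ennreal c * emeasure lborel S"
proof
  let ?L = "\<lambda>z::real^2. z$1 *\<^sub>R (y 1 - y 3) + z$2 *\<^sub>R (y 2 - y 3)"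
  let ?c = "\<bar>det (matrix ?L)\<bar>"
  show "0 < ?c"
    using inj_linear_bary_param[OF nc] det_nz_iff_inj[OF linear_bary_param] by simp
  fix S :: "(real^2) set" assume S: "S \<in> sets borel" "bounded S"
  have lS: "S \<in> lmeasurable"
    using S by (intro bounded_set_imp_lmeasurable sets_completionI_sets) simp_all
  have lLS: "?L ` S \<in> lmeasurable" and mLS: "measure lebesgue (?L ` S) = ?c * measure lebesgue S"
    using measurable_linear_image[OF linear_bary_param lS] measure_linear_image[OF linear_bary_param lS]
    by blast+
  have im: "bary_param y ` S = (+) (y 3) ` ?L ` S"
    by (simp add: image_image bary_param_eq)
  have "emeasure lborel (bary_param y ` S) = emeasure lebesgue (bary_param y ` S)"
    using sets_bary_param_image[OF nc S(1)] by simp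
  also have "\<dots> = ennreal (measure lebesgue (bary_param y ` S))"
    unfolding im using lLS by (intro emeasure_eq_measure2 measurable_translation)
  also have "\<dots> = ennreal ?c * ennreal (measure lebesgue S)"
    unfolding im measure_translation mLS by (simp add: ennreal_mult)
  also have "ennreal (measure lebesgue S) = emeasure lborel S"
    using emeasure_eq_measure2[OF lS] S(1) by simp
  finally show "emeasure lborel (bary_param y ` S) = ennreal ?c * emeasure lborel S" .
qed

lemma bounded_std_triangle: "bounded std_triangle"
proof (rule bounded_subset)
  show "std_triangle \<subseteq> cbox 0 1"
    by (auto simp: std_triangle_def mem_box_cart forall_2 forall_3)
qed simp

lemma distr_uniform_inv_bary_param:
  assumes nc: "\<not> collinear (range y)"
  shows "distr (uniform_measure lborel (closed_triangle y)) borel (inv (bary_param y))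
    = uniform_measure lborel std_triangle"
proof (rule measure_eqI)
  fix E assume "E \<in> sets (distr (uniform_measure lborel (closed_triangle y)) borel (inv (bary_param y)))"
  then have E: "E \<in> sets borel" by simp
  have bij: "bij (bary_param y)" by (rule bij_bary_param[OF nc])
  obtain c where c: "0 < c" "\<And>S. S \<in> sets borel \<Longrightarrow> bounded S \<Longrightarrow>
      emeasure lborel (bary_param y ` S) = ennreal c * emeasure lborel S"
    using emeasure_bary_param_image[OF nc] by blast
  have T: "closed_triangle y \<in> sets borel"
    unfolding closed_triangle_eq by (intro sets_bary_param_image nc sets_std_triangle)
  have "inv (bary_param y) -` E = bary_param y ` E"
    using bij by (simp add: bij_vimage_eq_inv_image bij_imp_bij_inv inv_inv_eq)
  then have int: "closed_triangle y \<inter> inv (bary_param y) -` E = bary_param y ` (std_triangle \<inter> E)"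
    using bij by (simp add: closed_triangle_eq image_Int bij_is_inj)
  have "emeasure (distr (uniform_measure lborel (closed_triangle y)) borel (inv (bary_param y))) E
      = emeasure lborel (bary_param y ` (std_triangle \<inter> E)) / emeasure lborel (bary_param y ` std_triangle)"
    using E T measurable_sets[OF measurable_inv_bary_param[OF nc] E] measurable_inv_bary_param[OF nc]
    by (simp add: emeasure_distr int) (simp add: closed_triangle_eq)
  also have "\<dots> = (ennreal c * emeasure lborel (std_triangle \<inter> E)) / (ennreal c * emeasure lborel std_triangle)"
    using E sets_std_triangle bounded_std_triangle by (simp add: c(2) bounded_Int)
  \<comment> \<open>The area factor is positive and finite, so it cancels.\<close>
  also have "\<dots> = emeasure lborel (std_triangle \<inter> E) / emeasure lborel std_triangle"
    using c(1) by (simp add: mult.commute[of "ennreal c"] divide_mult_eq)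
  also have "\<dots> = emeasure (uniform_measure lborel std_triangle) E"
    using E sets_std_triangle by simp
  finally show "emeasure (distr (uniform_measure lborel (closed_triangle y)) borel (inv (bary_param y))) E
      = emeasure (uniform_measure lborel std_triangle) E" .
qed simp

section \<open>The law of the domination number\<close>

lemma measurable_completion_AE_eq:
  assumes f: "f \<in> M \<rightarrow>\<^sub>M count_space UNIV" and ae: "AE x in M. g x = f x"
  shows "g \<in> completion M \<rightarrow>\<^sub>M count_space UNIV"
proof (rule measurableI)
  fix A :: "'b set"
  \<comment> \<open>The preimage of \<open>A\<close> under \<open>g\<close> is that of
    \<open>f\<close> with the exceptional set \<open>E\<close> removed and its part \<open>F\<close>
    added; both are null, hence measurable in the completion.\<close>
  define E where "E = (\<lambda>x. g x \<noteq> f x)"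
  define F where "F = (\<lambda>x. g x \<in> A \<and> g x \<noteq> f x)"
  have "AE x in M. \<not> E x" "AE x in M. \<not> F x"
    using ae by (auto simp: E_def F_def elim: eventually_mono)
  note null = this[THEN sets_completion_AE]
  have "Measurable.pred (completion M) (\<lambda>x. f x \<in> A)"
    using measurable_sets[OF measurable_completion[OF f], of A]
    by (simp add: pred_def vimage_def Int_def conj_commute)
  then have "Measurable.pred (completion M) (\<lambda>x. (f x \<in> A \<and> \<not> E x) \<or> F x)"
    using null by (intro pred_intros_logic)
  also have "(\<lambda>x. (f x \<in> A \<and> \<not> E x) \<or> F x) = (\<lambda>x. g x \<in> A)"
    by (auto simp: E_def F_def)
  finally show "g -` A \<inter> space (completion M) \<in> sets (completion M)"
    by (simp add: pred_def vimage_def Int_def conj_commute)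
qed simp

text \<open>The law on the right depends only on \<open>m\<close>, \<open>r\<close> and
  \<open>n\<close>, so it is shared by all triangles and all admissible assignments.\<close>

lemma distr_pe_domination_number:
  assumes nc: "\<not> collinear (range y)" and pos: "\<And>j. 0 < std_bary m j"
    and v: "vertex_assignment y (bary_param y m) v" and r: "1 \<le> r" and n: "1 \<le> n"
    and P: "prob_space P" and X: "iid_uniform P n X (closed_triangle y)"
  defines "D \<equiv> pe_domination_number y v r n X"
  shows "D \<in> completion P \<rightarrow>\<^sub>M count_space UNIV"
    and "distr (completion P) (count_space UNIV) D =
      distr (\<Pi>\<^sub>M i\<in>{1..n}. uniform_measure lborel std_triangle) (count_space UNIV) (std_domination_number m r n)"
proof -
  interpret prob_space P by fact
  define Z where "Z i \<omega> = inv (bary_param y) (X i \<omega>)" for i \<omega>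
  let ?U = "uniform_measure lborel std_triangle :: (real^2) measure"
  let ?D = "\<lambda>\<omega>. std_domination_number m r n (\<lambda>i\<in>{1..n}. Z i \<omega>)"
  have indX: "indep_vars (\<lambda>_. borel) X {1..n}"
    and distrX: "\<And>i. i \<in> {1..n} \<Longrightarrow> distr P borel (X i) = uniform_measure lborel (closed_triangle y)"
    using X by (auto simp: iid_uniform_def)
  have mX: "X i \<in> P \<rightarrow>\<^sub>M borel" if "i \<in> {1..n}" for i
    using indX that by (auto simp: indep_vars_def)
  have indZ: "indep_vars (\<lambda>_. borel) Z {1..n}"
    unfolding Z_def by (rule indep_vars_compose2[OF indX]) (rule measurable_inv_bary_param[OF nc])
  have mZ: "Z i \<in> P \<rightarrow>\<^sub>M borel" if "i \<in> {1..n}" for i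
    using indZ that by (auto simp: indep_vars_def)
  have distrZ: "distr P borel (Z i) = ?U" if "i \<in> {1..n}" for i
  proof -
    have "distr P borel (Z i) = distr (distr P borel (X i)) borel (inv (bary_param y))"
      unfolding Z_def[abs_def]
      by (subst distr_distr) (auto simp: o_def measurable_inv_bary_param[OF nc] mX[OF that])
    then show ?thesis
      by (simp add: distrX[OF that] distr_uniform_inv_bary_param[OF nc])
  qed
  have joint: "distr P (\<Pi>\<^sub>M i\<in>{1..n}. borel) (\<lambda>\<omega>. \<lambda>i\<in>{1..n}. Z i \<omega>) = (\<Pi>\<^sub>M i\<in>{1..n}. ?U)"
  proof -
    \<comment> \<open>Independence is equivalent to a product joint law over a nonempty index set;
      \<open>n \<ge> 1\<close> provides this.\<close>
    have "distr P (\<Pi>\<^sub>M i\<in>{1..n}. borel) (\<lambda>\<omega>. \<lambda>i\<in>{1..n}. Z i \<omega>) = (\<Pi>\<^sub>M i\<in>{1..n}. distr P borel (Z i))"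
      using indep_vars_iff_distr_eq_PiM'[of "{1..n}" Z "\<lambda>_. borel"] indZ mZ n by simp
    also have "\<dots> = (\<Pi>\<^sub>M i\<in>{1..n}. ?U)"
      using distrZ by (intro PiM_cong) auto
    finally show ?thesis .
  qed
  have mtuple: "(\<lambda>\<omega>. \<lambda>i\<in>{1..n}. Z i \<omega>) \<in> P \<rightarrow>\<^sub>M (\<Pi>\<^sub>M i\<in>{1..n}. borel)"
    using mZ by (intro measurable_restrict) auto
  have mD: "?D \<in> P \<rightarrow>\<^sub>M count_space UNIV"
    by (rule measurable_compose[OF mtuple measurable_std_domination_number])
  have "AE z in ?U. z \<in> std_triangle \<and> \<not> tie m z"
    using AE_not_tie[OF pos] by (intro AE_uniform_measureI) (auto elim: eventually_mono)
  then have "AE \<omega> in P. Z i \<omega> \<in> std_triangle \<and> \<not> tie m (Z i \<omega>)" if "i \<in> {1..n}" for i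
    using AE_distrD[OF mZ[OF that], of "\<lambda>z. z \<in> std_triangle \<and> \<not> tie m z"] that
    by (simp only: distrZ)
  then have "AE \<omega> in P. \<forall>i\<in>{1..n}. Z i \<omega> \<in> std_triangle \<and> \<not> tie m (Z i \<omega>)"
    by (intro AE_finite_allI) auto
  \<comment> \<open>Almost surely all points avoid the ties at once, and there the choices made by
    \<open>v\<close> have no effect.\<close>
  then have ae: "AE \<omega> in P. D \<omega> = ?D \<omega>"
  proof (rule eventually_mono)
    fix \<omega> assume "\<forall>i\<in>{1..n}. Z i \<omega> \<in> std_triangle \<and> \<not> tie m (Z i \<omega>)"
    then show "D \<omega> = ?D \<omega>"
      unfolding D_def
      using bij_is_surj[OF bij_bary_param[OF nc]]
      by (intro pe_domination_number_eq_std[OF nc pos v r]) (auto simp: Z_def surj_f_inv_f)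
  qed
  show mD': "D \<in> completion P \<rightarrow>\<^sub>M count_space UNIV"
    by (rule measurable_completion_AE_eq[OF mD ae])
  \<comment> \<open>The null set is removed in the completion, where \<open>D\<close> is measurable;
    \<open>?D\<close> is measurable for \<open>P\<close> itself, so its law is the same under both
    measures.\<close>
  have "distr (completion P) (count_space UNIV) D = distr (completion P) (count_space UNIV) ?D"
    using ae mD' measurable_completion[OF mD] by (intro distr_cong_AE AE_completion) auto
  also have "\<dots> = distr P (count_space UNIV) ?D"
    by (rule distr_completion[OF mD])
  also have "\<dots> = distr (distr P (\<Pi>\<^sub>M i\<in>{1..n}. borel) (\<lambda>\<omega>. \<lambda>i\<in>{1..n}. Z i \<omega>)) (count_space UNIV)
      (std_domination_number m r n)"
    by (simp only: distr_distr[OF measurable_std_domination_number mtuple] o_def)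
  finally show "distr (completion P) (count_space UNIV) D =
      distr (\<Pi>\<^sub>M i\<in>{1..n}. ?U) (count_space UNIV) (std_domination_number m r n)"
    by (simp only: joint)
qed

theorem theorem4:
  fixes y y' :: "3 \<Rightarrow> real^2"
    and M M' :: "real^2"
    and \<beta> :: "3 \<Rightarrow> real"
    and v v' :: "real^2 \<Rightarrow> 3"
    and r :: ereal
    and n :: nat
    and P :: "'a measure" and X :: "nat \<Rightarrow> 'a \<Rightarrow> real^2"
    and P' :: "'b measure" and X' :: "nat \<Rightarrow> 'b \<Rightarrow> real^2"
  assumes "\<not> collinear (range y)" and "\<not> collinear (range y')"
    and "M \<in> interior (closed_triangle y)" and "M' \<in> interior (closed_triangle y')"
    and "(\<Sum>j\<in>UNIV. \<beta> j) = 1"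
    and "M = (\<Sum>j\<in>UNIV. \<beta> j *\<^sub>R y j)" and "M' = (\<Sum>j\<in>UNIV. \<beta> j *\<^sub>R y' j)"
    and "vertex_assignment y M v" and "vertex_assignment y' M' v'"
    and "1 \<le> r" and "1 \<le> n"
    and "prob_space P" and "iid_uniform P n X (closed_triangle y)"
    and "prob_space P'" and "iid_uniform P' n X' (closed_triangle y')"
  shows "same_distribution P (pe_domination_number y v r n X)
                           P' (pe_domination_number y' v' r n X')"
proof -
  \<comment> \<open>One reference point \<open>m\<close> represents both \<open>M\<close> and
    \<open>M'\<close>, so both laws are the same reference law.\<close>
  obtain m where m: "std_bary m = \<beta>"
    using std_bary_onto[OF assms(5)] .
  have M: "M = bary_param y m" "M' = bary_param y' m"
    by (simp_all add: bary_param_def m assms)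
  have pos: "0 < std_bary m j" for j
    using interior_std_bary_pos[OF assms(1)] assms(3) M(1) by blast
  note * = distr_pe_domination_number[OF _ pos _ \<open>1 \<le> r\<close> \<open>1 \<le> n\<close>]
  show ?thesis
    using *[OF assms(1) assms(8)[unfolded M] assms(12,13)]
      *[OF assms(2) assms(9)[unfolded M] assms(14,15)]
    by (simp add: same_distribution_def)
qed

end
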